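(* Let $\Gamma$ and $\Delta$ be contexts and let $\varrho$ be a substitution from $\Gamma$ to $\Delta$. Suppose that for every context $\Xi$ of fresh variables, all variables $a^A, b^B \in \{\Xi,\Gamma\}$ with $A\equiv[A_1,\dots,A_n]$ and $B\equiv[B_1,\dots,B_m]$, and all $M_i\in\Lambda^{\Xi,\Delta}(A_i)$, $N_i\in\Lambda^{\Xi,\Delta}(B_i)$, we have $$\varrho^\Xi_a\,M_1\cdots M_n =_{\beta\eta} \varrho^\Xi_b\,N_1\cdots N_m \implies a=b \text{ and } M_i=N_i \text{ for all } i.$$ Then $\varrho$ is a strong reduction, i.e. for every context $\Xi$ of fresh variables the map $\hat\varrho^\Xi\colon\Lambda^{\Xi,\Gamma}(0)\to\Lambda^{\Xi,\Delta}(0)$ is injective.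
   Context: Simply typed $\lambda$-calculus over a single base type $0$. Every type can be written uniquely as $[A_1,\dots,A_n]:=A_1\to\cdots\to A_n\to 0$ ($n\ge 0$; $[\,]=0$); the $A_i$ are its components. A context is a finite list $\Gamma=x_1^{C_1},\dots,x_k^{C_k}$ of distinct typed variables; $\{\Gamma\}$ is its set of (typed) variables; concatenation $\Xi,\Gamma$ assumes disjoint variables. Terms are identified up to $\beta\eta$-conversion (equivalently represented by $\beta$-normal $\eta$-long forms), and $=_{\beta\eta}$ denotes this equality. $\Lambda^{\Xi}(A)$ is the set of terms of type $A$ with free variables among $\{\Xi\}$. A substitution $\varrho$ from $\Gamma$ to $\Delta$ assigns to each $c^C\in\{\Gamma\}$ a term $\varrho_c\in\Lambda^{\Delta}(C)$. For a context $\Xi$ of fresh variables (disjoint from those of $\Gamma,\Delta$), $\varrho^\Xi$ is the substitution from $\Xi,\Gamma$ to $\Xi,\Delta$ with $\varrho^\Xi_c=\varrho_c$ for $c\in\{\Gamma\}$ and $\varrho^\Xi_d=d$ for $d\in\{\Xi\}$, and $\hat\varrho^\Xi\colon\Lambda^{\Xi,\Gamma}(0)\to\Lambda^{\Xi,\Delta}(0)$ is $M\mapsto M[\Gamma:=\varrho]$ (simultaneous substitution of $\varrho_c$ for each $c\in\{\Gamma\}$). *)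

theory Defs
  imports Main
begin

datatype ty = Base | Fun ty ty (infixr \<open>\<rightarrow>\<^sub>t\<close> 65)

definition tys :: "ty list \<Rightarrow> ty" where
  "tys As = foldr (\<rightarrow>\<^sub>t) As Base"

text \<open>Typed variables \<open>x\<^sup>C\<close>; there are infinitely many of each type.\<close>

datatype var = Var (vname: nat) (vty: ty)

text \<open>Locally nameless, type-annotated terms: free variables are typed names, bound variables
  are de Bruijn indices, so alpha-equivalent terms are equal.\<close>

datatype trm = FVar var | BVar nat | App trm trm (infixl \<open>\<cdot>\<close> 70) | Abs ty trm

primrec lift :: "nat \<Rightarrow> trm \<Rightarrow> trm" where
  "lift k (FVar x) = FVar x"
| "lift k (BVar i) = BVar (if i < k then i else Suc i)"
| "lift k (M \<cdot> N) = lift k M \<cdot> lift k N"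
| "lift k (Abs A M) = Abs A (lift (Suc k) M)"

text \<open>\<open>inst k N M\<close> substitutes \<open>N\<close> for the bound variable \<open>k\<close> in \<open>M\<close> and lowers the
  indices above \<open>k\<close>.\<close>

primrec inst :: "nat \<Rightarrow> trm \<Rightarrow> trm \<Rightarrow> trm" where
  "inst k N (FVar x) = FVar x"
| "inst k N (BVar i) = (if i < k then BVar i else if i = k then N else BVar (i - 1))"
| "inst k N (M \<cdot> M') = inst k N M \<cdot> inst k N M'"
| "inst k N (Abs A M) = Abs A (inst (Suc k) (lift 0 N) M)"

primrec fv :: "trm \<Rightarrow> var set" where
  "fv (FVar x) = {x}"
| "fv (BVar i) = {}"
| "fv (M \<cdot> N) = fv M \<union> fv N"
| "fv (Abs A M) = fv M"

text \<open>The list \<open>\<Theta>\<close> gives the types of the dangling bound variables only.\<close>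

inductive typing :: "ty list \<Rightarrow> trm \<Rightarrow> ty \<Rightarrow> bool" (\<open>_ \<turnstile> _ \<Ztypecolon> _\<close> [50, 50, 50] 50) where
  FVar: "\<Theta> \<turnstile> FVar x \<Ztypecolon> vty x"
| BVar: "i < length \<Theta> \<Longrightarrow> \<Theta> \<turnstile> BVar i \<Ztypecolon> \<Theta> ! i"
| App: "\<Theta> \<turnstile> M \<Ztypecolon> A \<rightarrow>\<^sub>t B \<Longrightarrow> \<Theta> \<turnstile> N \<Ztypecolon> A \<Longrightarrow> \<Theta> \<turnstile> M \<cdot> N \<Ztypecolon> B"
| Abs: "A # \<Theta> \<turnstile> M \<Ztypecolon> B \<Longrightarrow> \<Theta> \<turnstile> Abs A M \<Ztypecolon> A \<rightarrow>\<^sub>t B"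

text \<open>Conversion is a typed judgement: for type-annotated terms, untyped \<open>\<beta>\<eta>\<close>-conversion
  may pass through ill-typed terms.\<close>

inductive conv :: "ty list \<Rightarrow> trm \<Rightarrow> trm \<Rightarrow> ty \<Rightarrow> bool"
    (\<open>_ \<turnstile> _ \<approx> _ \<Ztypecolon> _\<close> [50, 50, 50, 50] 50) where
  refl: "\<Theta> \<turnstile> M \<Ztypecolon> A \<Longrightarrow> \<Theta> \<turnstile> M \<approx> M \<Ztypecolon> A"
| sym: "\<Theta> \<turnstile> M \<approx> N \<Ztypecolon> A \<Longrightarrow> \<Theta> \<turnstile> N \<approx> M \<Ztypecolon> A"
| trans: "\<Theta> \<turnstile> M \<approx> N \<Ztypecolon> A \<Longrightarrow> \<Theta> \<turnstile> N \<approx> P \<Ztypecolon> A \<Longrightarrow> \<Theta> \<turnstile> M \<approx> P \<Ztypecolon> A"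
| App: "\<Theta> \<turnstile> M \<approx> M' \<Ztypecolon> A \<rightarrow>\<^sub>t B \<Longrightarrow> \<Theta> \<turnstile> N \<approx> N' \<Ztypecolon> A \<Longrightarrow> \<Theta> \<turnstile> M \<cdot> N \<approx> M' \<cdot> N' \<Ztypecolon> B"
| Abs: "A # \<Theta> \<turnstile> M \<approx> M' \<Ztypecolon> B \<Longrightarrow> \<Theta> \<turnstile> Abs A M \<approx> Abs A M' \<Ztypecolon> A \<rightarrow>\<^sub>t B"
| beta: "A # \<Theta> \<turnstile> M \<Ztypecolon> B \<Longrightarrow> \<Theta> \<turnstile> N \<Ztypecolon> A \<Longrightarrow> \<Theta> \<turnstile> Abs A M \<cdot> N \<approx> inst 0 N M \<Ztypecolon> B"
| eta: "\<Theta> \<turnstile> M \<Ztypecolon> A \<rightarrow>\<^sub>t B \<Longrightarrow> \<Theta> \<turnstile> Abs A (lift 0 M \<cdot> BVar 0) \<approx> M \<Ztypecolon> A \<rightarrow>\<^sub>t B"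

abbreviation beta_eta_eq :: "trm \<Rightarrow> trm \<Rightarrow> ty \<Rightarrow> bool"
    (\<open>_ =\<^sub>\<beta>\<^sub>\<eta> _ \<Ztypecolon> _\<close> [50, 50, 50] 50) where
  "M =\<^sub>\<beta>\<^sub>\<eta> N \<Ztypecolon> A \<equiv> [] \<turnstile> M \<approx> N \<Ztypecolon> A"

definition apps :: "trm \<Rightarrow> trm list \<Rightarrow> trm" where
  "apps M Ns = foldl (\<cdot>) M Ns"

type_synonym ctx = "var list"

definition is_ctx :: "ctx \<Rightarrow> bool" where
  "is_ctx \<Gamma> \<longleftrightarrow> distinct \<Gamma>"

definition fresh_ctx :: "ctx \<Rightarrow> ctx \<Rightarrow> ctx \<Rightarrow> bool" where
  "fresh_ctx \<Xi> \<Gamma> \<Delta> \<longleftrightarrow> is_ctx \<Xi> \<and> set \<Xi> \<inter> (set \<Gamma> \<union> set \<Delta>) = {}"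

text \<open>Representatives of the terms of type \<open>A\<close> over \<open>\<Xi>\<close>; two of them denote the same term iff
  they are related by \<open>=\<^sub>\<beta>\<^sub>\<eta>\<close>.\<close>

definition Terms :: "ctx \<Rightarrow> ty \<Rightarrow> trm set" (\<open>\<Lambda>\<close>) where
  "\<Lambda> \<Xi> A = {M. [] \<turnstile> M \<Ztypecolon> A \<and> fv M \<subseteq> set \<Xi>}"

definition substitution :: "ctx \<Rightarrow> ctx \<Rightarrow> (var \<Rightarrow> trm) \<Rightarrow> bool" where
  "substitution \<Gamma> \<Delta> \<rho> \<longleftrightarrow> (\<forall>c \<in> set \<Gamma>. \<rho> c \<in> \<Lambda> \<Delta> (vty c))"

text \<open>The extension \<open>\<rho>\<^sup>\<Xi>\<close> of \<open>\<rho>\<close> by the identity on \<open>\<Xi>\<close>.\<close>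

definition subst_ext :: "ctx \<Rightarrow> (var \<Rightarrow> trm) \<Rightarrow> var \<Rightarrow> trm" where
  "subst_ext \<Xi> \<rho> c = (if c \<in> set \<Xi> then FVar c else \<rho> c)"

text \<open>Simultaneous substitution \<open>M[\<Gamma> := \<rho>]\<close>. No lifting is needed below an abstraction, since
  the terms \<open>\<rho> c\<close> have no dangling bound variables.\<close>

primrec subst :: "ctx \<Rightarrow> (var \<Rightarrow> trm) \<Rightarrow> trm \<Rightarrow> trm" where
  "subst \<Gamma> \<rho> (FVar x) = (if x \<in> set \<Gamma> then \<rho> x else FVar x)"
| "subst \<Gamma> \<rho> (BVar i) = BVar i"
| "subst \<Gamma> \<rho> (M \<cdot> N) = subst \<Gamma> \<rho> M \<cdot> subst \<Gamma> \<rho> N"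
| "subst \<Gamma> \<rho> (Abs A M) = Abs A (subst \<Gamma> \<rho> M)"

text \<open>Injectivity of \<open>M \<mapsto> M[\<Gamma> := \<rho>]\<close> as a map from \<open>\<Lambda> (\<Xi> @ \<Gamma>) Base\<close> to \<open>\<Lambda> (\<Xi> @ \<Delta>) Base\<close>,
  both modulo \<open>=\<^sub>\<beta>\<^sub>\<eta>\<close>; that this map is well defined is shown in \<open>subst_Terms\<close> and
  \<open>subst_conv\<close> below.\<close>

definition strong_reduction :: "ctx \<Rightarrow> ctx \<Rightarrow> (var \<Rightarrow> trm) \<Rightarrow> bool" where
  "strong_reduction \<Gamma> \<Delta> \<rho> \<longleftrightarrow>
     substitution \<Gamma> \<Delta> \<rho> \<and>
     (\<forall>\<Xi>. fresh_ctx \<Xi> \<Gamma> \<Delta> \<longrightarrow>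
       (\<forall>M \<in> \<Lambda> (\<Xi> @ \<Gamma>) Base. \<forall>N \<in> \<Lambda> (\<Xi> @ \<Gamma>) Base.
          subst \<Gamma> \<rho> M =\<^sub>\<beta>\<^sub>\<eta> subst \<Gamma> \<rho> N \<Ztypecolon> Base \<longrightarrow> M =\<^sub>\<beta>\<^sub>\<eta> N \<Ztypecolon> Base))"

lemma typing_weaken: "\<Theta> \<turnstile> M \<Ztypecolon> A \<Longrightarrow> \<Theta> @ \<Theta>' \<turnstile> M \<Ztypecolon> A"
proof (induction rule: typing.induct)
  case (BVar i \<Theta>)
  then show ?case
    using typing.BVar[of i "\<Theta> @ \<Theta>'"] by (simp add: nth_append)
qed (auto intro: typing.intros)

lemma typing_lift_id: "\<Theta> \<turnstile> M \<Ztypecolon> A \<Longrightarrow> length \<Theta> \<le> k \<Longrightarrow> lift k M = M"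
  by (induction arbitrary: k rule: typing.induct) auto

lemma typing_inst_id: "\<Theta> \<turnstile> M \<Ztypecolon> A \<Longrightarrow> length \<Theta> \<le> k \<Longrightarrow> inst k N M = M"
  by (induction arbitrary: k N rule: typing.induct) auto

lemma subst_typing:
  assumes "substitution \<Gamma> \<Delta> \<rho>"
  shows "\<Theta> \<turnstile> M \<Ztypecolon> A \<Longrightarrow> \<Theta> \<turnstile> subst \<Gamma> \<rho> M \<Ztypecolon> A"
proof (induction rule: typing.induct)
  case (FVar \<Theta> x)
  then show ?case
    using assms typing_weaken[of "[]" "\<rho> x" "vty x" \<Theta>]
    by (auto simp: substitution_def Terms_def intro: typing.intros)
qed (auto intro: typing.intros)

lemma subst_Terms:
  assumes \<rho>: "substitution \<Gamma> \<Delta> \<rho>" and M: "M \<in> \<Lambda> (\<Xi> @ \<Gamma>) A"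
  shows "subst \<Gamma> \<rho> M \<in> \<Lambda> (\<Xi> @ \<Delta>) A"
proof -
  have "fv M \<subseteq> set (\<Xi> @ \<Gamma>) \<Longrightarrow> fv (subst \<Gamma> \<rho> M) \<subseteq> set (\<Xi> @ \<Delta>)" for M
    using \<rho> by (induction M) (auto simp: substitution_def Terms_def)
  with M show ?thesis
    by (auto simp: Terms_def intro: subst_typing[OF \<rho>])
qed

lemma subst_lift:
  assumes "substitution \<Gamma> \<Delta> \<rho>"
  shows "subst \<Gamma> \<rho> (lift k M) = lift k (subst \<Gamma> \<rho> M)"
  using assms
  by (induction M arbitrary: k) (auto simp: substitution_def Terms_def typing_lift_id)

lemma subst_inst:
  assumes "substitution \<Gamma> \<Delta> \<rho>"
  shows "subst \<Gamma> \<rho> (inst k N M) = inst k (subst \<Gamma> \<rho> N) (subst \<Gamma> \<rho> M)"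
  using assms
  by (induction M arbitrary: k N)
    (auto simp: substitution_def Terms_def typing_inst_id subst_lift[OF assms])

lemma subst_conv:
  assumes \<rho>: "substitution \<Gamma> \<Delta> \<rho>"
  shows "\<Theta> \<turnstile> M \<approx> N \<Ztypecolon> A \<Longrightarrow> \<Theta> \<turnstile> subst \<Gamma> \<rho> M \<approx> subst \<Gamma> \<rho> N \<Ztypecolon> A"
proof (induction rule: conv.induct)
  case (trans \<Theta> M N A P)
  then show ?case by (blast intro: conv.trans)
next
  case (beta A \<Theta> M B N)
  then show ?case
    using conv.beta subst_typing[OF \<rho>] by (simp add: subst_inst[OF \<rho>])
next
  case (eta \<Theta> M A B)
  then show ?case
    using conv.eta subst_typing[OF \<rho>] by (simp add: subst_lift[OF \<rho>])
qed (auto intro: conv.intros subst_typing[OF \<rho>])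

lemma typing_insert:
  "\<Theta> \<turnstile> M \<Ztypecolon> A \<Longrightarrow> \<Theta> = \<Theta>1 @ \<Theta>2 \<Longrightarrow> \<Theta>1 @ B # \<Theta>2 \<turnstile> lift (length \<Theta>1) M \<Ztypecolon> A"
proof (induction arbitrary: \<Theta>1 rule: typing.induct)
  case (BVar i \<Theta>)
  then show ?case
    using typing.BVar[of "if i < length \<Theta>1 then i else Suc i" "\<Theta>1 @ B # \<Theta>2"]
    by (auto simp: nth_append Suc_diff_le split: if_splits)
next
  case (Abs A \<Theta> M C)
  then show ?case using Abs.IH[of "A # \<Theta>1"] by (auto intro: typing.intros)
qed (auto intro: typing.intros)

lemma typing_inst:
  "\<Theta> \<turnstile> M \<Ztypecolon> A \<Longrightarrow> \<Theta> = \<Theta>1 @ B # \<Theta>2 \<Longrightarrow> \<Theta>1 @ \<Theta>2 \<turnstile> N \<Ztypecolon> B \<Longrightarrow>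
     \<Theta>1 @ \<Theta>2 \<turnstile> inst (length \<Theta>1) N M \<Ztypecolon> A"
proof (induction arbitrary: \<Theta>1 N rule: typing.induct)
  case (BVar i \<Theta>)
  consider "i < length \<Theta>1" | "i = length \<Theta>1" | j where "i = Suc j" "length \<Theta>1 \<le> j"
    by (metis Suc_le_D Suc_le_mono Suc_leI linorder_neqE_nat)
  then show ?case
  proof cases
    case 1
    then show ?thesis
      using BVar typing.BVar[of i "\<Theta>1 @ \<Theta>2"] by (auto simp: nth_append)
  next
    case 2
    then show ?thesis using BVar by simp
  next
    case 3
    then show ?thesis
      using BVar typing.BVar[of j "\<Theta>1 @ \<Theta>2"] by (auto simp: nth_append Suc_diff_le)
  qed
next
  case (Abs A \<Theta> M C)
  have "A # \<Theta>1 @ \<Theta>2 \<turnstile> lift 0 N \<Ztypecolon> B"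
    using typing_insert[OF Abs.prems(2), of "[]"] by simp
  then show ?case
    using Abs.IH[of "A # \<Theta>1" "lift 0 N"] Abs.prems by (auto intro: typing.intros)
next
  case (App \<Theta> M A C M')
  then show ?case by (simp, blast intro: typing.App)
qed (auto intro: typing.intros)

lemma conv_typing: "\<Theta> \<turnstile> M \<approx> N \<Ztypecolon> A \<Longrightarrow> \<Theta> \<turnstile> M \<Ztypecolon> A \<and> \<Theta> \<turnstile> N \<Ztypecolon> A"
proof (induction rule: conv.induct)
  case (beta A \<Theta> M B N)
  then show ?case
    using typing_inst[of "A # \<Theta>" M B "[]" A \<Theta> N] by (auto intro: typing.intros)
next
  case (eta \<Theta> M A B)
  have "A # \<Theta> \<turnstile> lift 0 M \<Ztypecolon> A \<rightarrow>\<^sub>t B"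
    using typing_insert[OF eta, of "[]"] by simp
  moreover have "A # \<Theta> \<turnstile> BVar 0 \<Ztypecolon> A"
    using typing.BVar[of 0 "A # \<Theta>"] by simp
  ultimately show ?case using eta by (auto intro: typing.intros)
qed (auto intro: typing.intros)

end

theory Submission imports Defs begin

text \<open>Every term is convertible to a long normal form, by a Kripke logical predicate whose worlds
  are sets of free variables. Two terms of type \<open>0\<close> with equal images under the substitution have
  long normal forms \<open>a M\<^sub>1 \<dots> M\<^sub>n\<close> and \<open>b N\<^sub>1 \<dots> N\<^sub>m\<close>; the hypothesis gives \<open>a = b\<close> and equality of the
  images of the \<open>M\<^sub>i\<close> and \<open>N\<^sub>i\<close>. Applying these to fresh variables leads back to type \<open>0\<close> with smaller
  normal forms, and extensionality of conversion removes the fresh variables again. Confluence is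
  never needed.\<close>

section \<open>Extensionality of conversion\<close>

text \<open>Left inverse of \<open>inst k (FVar x)\<close> on terms without \<open>x\<close>: it
  turns a named variable into a bound one, so that an abstraction can be formed over it.\<close>

primrec close :: "nat \<Rightarrow> var \<Rightarrow> trm \<Rightarrow> trm" where
  "close k x (FVar y) = (if y = x then BVar k else FVar y)"
| "close k x (BVar i) = BVar (if i < k then i else Suc i)"
| "close k x (M \<cdot> N) = close k x M \<cdot> close k x N"
| "close k x (Abs A M) = Abs A (close (Suc k) x M)"

lemma close_fresh: "x \<notin> fv M \<Longrightarrow> close k x M = lift k M"
  by (induction M arbitrary: k) auto

lemma close_lift: "j \<le> k \<Longrightarrow> close (Suc k) x (lift j M) = lift j (close k x M)"
  by (induction M arbitrary: j k) auto

text \<open>\<open>M\<close> lies under one more binder than the result of \<open>inst\<close>,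
  hence \<open>Suc k\<close> there; \<open>j \<le> k\<close> keeps the new index from shifting the
  instantiated one.\<close>

lemma close_inst: "j \<le> k \<Longrightarrow> close k x (inst j N M) = inst j (close k x N) (close (Suc k) x M)"
  by (induction M arbitrary: j k N) (auto simp: close_lift)

lemma typing_close:
  "\<Theta> \<turnstile> M \<Ztypecolon> A \<Longrightarrow> \<Theta> = \<Theta>1 @ \<Theta>2 \<Longrightarrow> \<Theta>1 @ vty x # \<Theta>2 \<turnstile> close (length \<Theta>1) x M \<Ztypecolon> A"
proof (induction arbitrary: \<Theta>1 rule: typing.induct)
  case (FVar \<Theta> y)
  then show ?case
    using typing.BVar[of "length \<Theta>1" "\<Theta>1 @ vty x # \<Theta>2"] by (auto intro: typing.intros)
next
  case (BVar i \<Theta>)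
  then show ?case
    using typing.BVar[of "if i < length \<Theta>1 then i else Suc i" "\<Theta>1 @ vty x # \<Theta>2"]
    by (auto simp: nth_append Suc_diff_le split: if_splits)
next
  case (Abs A \<Theta> M C)
  then show ?case using Abs.IH[of "A # \<Theta>1"] by (auto intro: typing.intros)
qed (auto intro: typing.intros)

text \<open>The beta and eta rules are preserved because closing commutes with \<open>inst\<close>
  and \<open>lift\<close>. Splitting the context lets \<open>\<Theta>1\<close> grow when the
  induction passes under an abstraction.\<close>

lemma conv_close:
  "\<Theta> \<turnstile> M \<approx> N \<Ztypecolon> A \<Longrightarrow> \<Theta> = \<Theta>1 @ \<Theta>2 \<Longrightarrow>
     \<Theta>1 @ vty x # \<Theta>2 \<turnstile> close (length \<Theta>1) x M \<approx> close (length \<Theta>1) x N \<Ztypecolon> A"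
proof (induction arbitrary: \<Theta>1 rule: conv.induct)
  case (refl \<Theta> M A)
  then show ?case by (auto intro: conv.refl typing_close)
next
  case (sym \<Theta> M N A)
  then show ?case by (blast intro: conv.sym)
next
  case (trans \<Theta> M N A P)
  then show ?case by (blast intro: conv.trans)
next
  case (App \<Theta> M M' A B N N')
  then show ?case by (auto intro: conv.App)
next
  case (Abs A \<Theta> M M' B)
  then show ?case using Abs.IH[of "A # \<Theta>1"] by (auto intro: conv.Abs)
next
  case (beta A \<Theta> M B N)
  have "A # \<Theta>1 @ vty x # \<Theta>2 \<turnstile> close (Suc (length \<Theta>1)) x M \<Ztypecolon> B"
    using typing_close[OF beta(1), of "A # \<Theta>1"] beta(3) by simp
  moreover have "\<Theta>1 @ vty x # \<Theta>2 \<turnstile> close (length \<Theta>1) x N \<Ztypecolon> A"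
    using typing_close[OF beta(2)] beta(3) by simp
  ultimately show ?case by (simp add: close_inst conv.beta)
next
  case (eta \<Theta> M A B)
  then show ?case by (simp add: close_lift conv.eta typing_close)
qed

text \<open>Closing over \<open>x\<close> makes the hypothesis an equation about a bound variable,
  where freshness reduces closing to lifting. Abstracting both sides gives eta-expansions of
  \<open>M\<close> and \<open>N\<close>.\<close>

lemma conv_ext:
  assumes "[] \<turnstile> M \<cdot> FVar x \<approx> N \<cdot> FVar x \<Ztypecolon> B" and "x \<notin> fv M" "x \<notin> fv N"
    and "[] \<turnstile> M \<Ztypecolon> vty x \<rightarrow>\<^sub>t B" "[] \<turnstile> N \<Ztypecolon> vty x \<rightarrow>\<^sub>t B"
  shows "[] \<turnstile> M \<approx> N \<Ztypecolon> vty x \<rightarrow>\<^sub>t B"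
proof -
  have "[vty x] \<turnstile> lift 0 M \<cdot> BVar 0 \<approx> lift 0 N \<cdot> BVar 0 \<Ztypecolon> B"
    using conv_close[OF assms(1), of "[]" "[]" x] assms(2,3) by (simp add: close_fresh)
  then have "[] \<turnstile> Abs (vty x) (lift 0 M \<cdot> BVar 0) \<approx> Abs (vty x) (lift 0 N \<cdot> BVar 0) \<Ztypecolon> vty x \<rightarrow>\<^sub>t B"
    by (rule conv.Abs)
  then show ?thesis
    using conv.eta[OF assms(4)] conv.eta[OF assms(5)] by (meson conv.sym conv.trans)
qed

section \<open>Iterated application\<close>

lemma tys_inject: "tys As = tys Bs \<longleftrightarrow> As = Bs"
proof
  show "tys As = tys Bs \<Longrightarrow> As = Bs"
  proof (induction As arbitrary: Bs)
    case Nil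
    then show ?case by (cases Bs) (auto simp: tys_def)
  next
    case (Cons A As)
    then show ?case by (cases Bs) (auto simp: tys_def)
  qed
qed simp

lemma apps_snoc: "apps M (Ns @ [N]) = apps M Ns \<cdot> N"
  by (simp add: apps_def)

lemma apps_Cons: "apps M (N # Ns) = apps (M \<cdot> N) Ns"
  by (simp add: apps_def)

lemma apps_Nil [simp]: "apps M [] = M"
  by (simp add: apps_def)

lemma subst_apps: "subst \<Gamma> \<rho> (apps M Ns) = apps (subst \<Gamma> \<rho> M) (map (subst \<Gamma> \<rho>) Ns)"
  by (induction Ns arbitrary: M) (simp_all add: apps_Cons)

lemma fv_apps: "fv (apps M Ns) = fv M \<union> (\<Union>N \<in> set Ns. fv N)"
  by (induction Ns arbitrary: M) (auto simp: apps_Cons)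

lemma typing_apps:
  "list_all2 (\<lambda>N A. \<Theta> \<turnstile> N \<Ztypecolon> A) Ns As \<Longrightarrow> \<Theta> \<turnstile> M \<Ztypecolon> foldr (\<rightarrow>\<^sub>t) As B \<Longrightarrow> \<Theta> \<turnstile> apps M Ns \<Ztypecolon> B"
  by (induction arbitrary: M rule: list_all2_induct) (auto simp: apps_Cons intro: typing.intros)

lemma conv_apps:
  assumes "length Ms = length As" "length Ns = length As"
    and "\<forall>i < length As. \<Theta> \<turnstile> Ms ! i \<approx> Ns ! i \<Ztypecolon> As ! i"
    and "\<Theta> \<turnstile> M \<approx> N \<Ztypecolon> foldr (\<rightarrow>\<^sub>t) As B"
  shows "\<Theta> \<turnstile> apps M Ms \<approx> apps N Ns \<Ztypecolon> B"
  using assms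
proof (induction As arbitrary: Ms Ns M N)
  case (Cons A As)
  then obtain P Ps Q Qs where eq: "Ms = P # Ps" "Ns = Q # Qs"
    by (metis length_Suc_conv)
  have "\<Theta> \<turnstile> P \<approx> Q \<Ztypecolon> A" using Cons.prems(3) eq by force
  then have "\<Theta> \<turnstile> M \<cdot> P \<approx> N \<cdot> Q \<Ztypecolon> foldr (\<rightarrow>\<^sub>t) As B"
    using Cons.prems(4) by (auto intro: conv.App)
  moreover have "\<forall>i < length As. \<Theta> \<turnstile> Ps ! i \<approx> Qs ! i \<Ztypecolon> As ! i"
    using Cons.prems(3) eq by force
  ultimately show ?case
    using Cons.IH[of Ps Qs "M \<cdot> P" "N \<cdot> Q"] Cons.prems(1,2) eq by (simp add: apps_Cons)
qed simp

section \<open>Normalization\<close>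

definition terms_over :: "var set \<Rightarrow> ty \<Rightarrow> trm set" where
  "terms_over S A = {M. [] \<turnstile> M \<Ztypecolon> A \<and> fv M \<subseteq> S}"

lemma Terms_eq_terms_over: "\<Lambda> \<Xi> A = terms_over (set \<Xi>) A"
  by (simp add: Terms_def terms_over_def)

lemma terms_over_mono: "M \<in> terms_over S A \<Longrightarrow> S \<subseteq> S' \<Longrightarrow> M \<in> terms_over S' A"
  by (auto simp: terms_over_def)

lemma terms_over_App:
  "M \<in> terms_over S (A \<rightarrow>\<^sub>t B) \<Longrightarrow> N \<in> terms_over S A \<Longrightarrow> M \<cdot> N \<in> terms_over S B"
  by (auto simp: terms_over_def intro: typing.intros)

lemma terms_over_FVar: "x \<in> S \<Longrightarrow> FVar x \<in> terms_over S (vty x)"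
  by (auto simp: terms_over_def intro: typing.intros)

text \<open>\<open>norm S M A\<close>: up to conversion \<open>M\<close> has a long normal form with free variables in \<open>S\<close>. Instead
  of entering abstractions, a term of function type is applied to a fresh variable.\<close>

inductive norm :: "var set \<Rightarrow> trm \<Rightarrow> ty \<Rightarrow> bool" where
  Base: "M \<in> terms_over S Base \<Longrightarrow> a \<in> S \<Longrightarrow> vty a = tys As \<Longrightarrow> list_all2 (norm S) Ms As \<Longrightarrow>
    [] \<turnstile> M \<approx> apps (FVar a) Ms \<Ztypecolon> Base \<Longrightarrow> norm S M Base"
| Fun: "M \<in> terms_over S (A \<rightarrow>\<^sub>t B) \<Longrightarrow>
    (\<And>x. x \<notin> S \<Longrightarrow> vty x = A \<Longrightarrow> norm (insert x S) (M \<cdot> FVar x) B) \<Longrightarrow> norm S M (A \<rightarrow>\<^sub>t B)"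

lemma norm_terms_over: "norm S M A \<Longrightarrow> M \<in> terms_over S A"
  by (erule norm.cases) auto

text \<open>A variable outside \<open>S'\<close> is also outside \<open>S\<close>. Thus the rule
  \<open>norm.Fun\<close>, which demands all fresh variables and not just one, makes the function
  case immediate.\<close>

lemma norm_mono: "norm S M A \<Longrightarrow> S \<subseteq> S' \<Longrightarrow> norm S' M A"
proof (induction arbitrary: S' rule: norm.induct)
  case (Base M S a As Ms)
  have "list_all2 (norm S') Ms As"
    using Base.IH Base.prems by (auto elim: list_all2_mono)
  then show ?case
    using Base by (blast intro: norm.Base terms_over_mono)
next
  case (Fun M S A B)
  then show ?case
    by (intro norm.Fun Fun.IH) (auto intro: terms_over_mono)
qed

lemma norm_conv:
  "norm S N Base \<Longrightarrow> [] \<turnstile> M \<approx> N \<Ztypecolon> Base \<Longrightarrow> M \<in> terms_over S Base \<Longrightarrow> norm S M Base"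
  by (erule norm.cases) (auto intro: norm.Base conv.trans)

section \<open>The logical predicate: reification and reflection\<close>

text \<open>Ranging over all \<open>S'\<close> above \<open>S\<close> allows arguments with new free
  variables; in particular a fresh variable can be supplied to a term of function type.\<close>

primrec red :: "ty \<Rightarrow> var set \<Rightarrow> trm \<Rightarrow> bool" where
  "red Base S M \<longleftrightarrow> norm S M Base"
| "red (A \<rightarrow>\<^sub>t B) S M \<longleftrightarrow> M \<in> terms_over S (A \<rightarrow>\<^sub>t B) \<and>
     (\<forall>S' N. S \<subseteq> S' \<longrightarrow> red A S' N \<longrightarrow> red B S' (M \<cdot> N))"

lemma red_terms_over: "red A S M \<Longrightarrow> M \<in> terms_over S A"
  by (cases A) (auto intro: norm_terms_over)

lemma red_mono: "red A S M \<Longrightarrow> S \<subseteq> S' \<Longrightarrow> red A S' M"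
  by (cases A) (auto intro: norm_mono terms_over_mono)

text \<open>Used for closure under beta-expansion in \<open>red_minst\<close>. At function types,
  congruence of application passes the conversion on to the codomain.\<close>

lemma red_conv:
  "red A S N \<Longrightarrow> [] \<turnstile> M \<approx> N \<Ztypecolon> A \<Longrightarrow> M \<in> terms_over S A \<Longrightarrow> red A S M"
proof (induction A arbitrary: S M N)
  case Base
  then show ?case by (auto intro: norm_conv)
next
  case (Fun A B)
  have "red B S' (M \<cdot> P)" if "S \<subseteq> S'" "red A S' P" for S' P
  proof (rule Fun.IH(2))
    show "red B S' (N \<cdot> P)" using Fun.prems that by auto
    have P: "P \<in> terms_over S' A" using that red_terms_over by blast
    then show "[] \<turnstile> M \<cdot> P \<approx> N \<cdot> P \<Ztypecolon> B"
      using Fun.prems(2) by (auto simp: terms_over_def intro: conv.App conv.refl)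
    show "M \<cdot> P \<in> terms_over S' B"
      using P Fun.prems(3) that by (blast intro: terms_over_App terms_over_mono)
  qed
  then show ?case using Fun.prems by auto
qed

lemma apps_terms_over:
  assumes "a \<in> S" "vty a = foldr (\<rightarrow>\<^sub>t) As A" "list_all2 (norm S) Ms As"
  shows "apps (FVar a) Ms \<in> terms_over S A"
proof -
  have "list_all2 (\<lambda>M A. M \<in> terms_over S A) Ms As"
    using assms(3) by (auto elim: list_all2_mono intro: norm_terms_over)
  then have "list_all2 (\<lambda>M A. [] \<turnstile> M \<Ztypecolon> A) Ms As" "\<forall>M \<in> set Ms. fv M \<subseteq> S"
    by (fastforce simp: terms_over_def list_all2_conv_all_nth in_set_conv_nth)+
  then show ?thesis
    using assms typing_apps[of "[]" Ms As "FVar a" A] typing.FVar[of "[]" a]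
    by (auto simp: terms_over_def fv_apps)
qed

text \<open>The two claims need each other, so they are proved by one induction on the type:
  reifying at a function type reflects a variable of the domain, and reflecting there reifies the
  argument.\<close>

lemma reify_reflect:
  shows red_norm: "red A S M \<Longrightarrow> norm S M A"
    and apps_red: "a \<in> S \<Longrightarrow> vty a = foldr (\<rightarrow>\<^sub>t) As A \<Longrightarrow> list_all2 (norm S) Ms As \<Longrightarrow>
      red A S (apps (FVar a) Ms)"
proof (induction A arbitrary: S M a As Ms)
  case Base
  {
    case 1
    then show ?case by simp
  next
    case 2
    then have "apps (FVar a) Ms \<in> terms_over S Base" by (rule apps_terms_over)
    then show ?case
      using 2 by (auto simp: terms_over_def tys_def intro!: norm.Base conv.refl)
  }
next
  case (Fun A B)
  {
    case 1
    show ?case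
    proof (rule norm.Fun)
      show "M \<in> terms_over S (A \<rightarrow>\<^sub>t B)" using 1 by simp
      fix x assume "x \<notin> S" "vty x = A"
      \<comment> \<open>A variable is the case of an empty argument list.\<close>
      then have "red A (insert x S) (FVar x)"
        using Fun.IH(2)[of x "insert x S" "[]" "[]"] by simp
      then show "norm (insert x S) (M \<cdot> FVar x) B"
        using 1 by (intro Fun.IH(3)) (auto simp del: insert_iff)
    qed
  next
    case 2
    have "red B S' (apps (FVar a) Ms \<cdot> N)" if "S \<subseteq> S'" "red A S' N" for S' N
    proof -
      \<comment> \<open>The reducible argument \<open>N\<close> is reified and joins the argument
        list, so that reflection at \<open>B\<close> applies to the longer one.\<close>
      have "list_all2 (norm S') (Ms @ [N]) (As @ [A])"
        using Fun.IH(1)[OF that(2)] 2(3) that(1)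
        by (auto intro!: list_all2_appendI elim!: list_all2_mono intro: norm_mono)
      then show ?thesis
        using Fun.IH(4)[of a S' "As @ [A]" "Ms @ [N]"] 2 that(1) by (auto simp: apps_snoc)
    qed
    then show ?case using apps_terms_over[OF 2] by simp
  }
qed

section \<open>Parallel instantiation and the fundamental lemma\<close>

text \<open>\<open>minst k \<sigma> M\<close> replaces the bound variables from \<open>k\<close> on by the terms in \<open>\<sigma>\<close>, which are
  assumed to have no dangling bound variables.\<close>

primrec minst :: "nat \<Rightarrow> trm list \<Rightarrow> trm \<Rightarrow> trm" where
  "minst k \<sigma> (FVar x) = FVar x"
| "minst k \<sigma> (BVar i) = (if i < k then BVar i else \<sigma> ! (i - k))"
| "minst k \<sigma> (M \<cdot> N) = minst k \<sigma> M \<cdot> minst k \<sigma> N"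
| "minst k \<sigma> (Abs A M) = Abs A (minst (Suc k) \<sigma> M)"

lemma minst_Nil: "\<Theta> \<turnstile> M \<Ztypecolon> A \<Longrightarrow> minst (length \<Theta>) [] M = M"
  by (induction rule: typing.induct) auto

lemma typing_minst:
  "\<Theta> \<turnstile> M \<Ztypecolon> A \<Longrightarrow> \<Theta> = \<Theta>1 @ \<Theta>2 \<Longrightarrow> list_all2 (\<lambda>N B. [] \<turnstile> N \<Ztypecolon> B) \<sigma> \<Theta>2 \<Longrightarrow>
     \<Theta>1 \<turnstile> minst (length \<Theta>1) \<sigma> M \<Ztypecolon> A"
proof (induction arbitrary: \<Theta>1 rule: typing.induct)
  case (BVar i \<Theta>)
  show ?case
  proof (cases "i < length \<Theta>1")
    case True
    then show ?thesis using BVar typing.BVar[of i \<Theta>1] by (simp add: nth_append)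
  next
    case False
    then have "[] \<turnstile> \<sigma> ! (i - length \<Theta>1) \<Ztypecolon> \<Theta> ! i"
      using BVar by (auto simp: list_all2_conv_all_nth nth_append)
    then show ?thesis using False typing_weaken[of "[]"] by simp
  qed
next
  case (Abs A \<Theta> M C)
  then show ?case using Abs.IH[of "A # \<Theta>1"] by (auto intro: typing.intros)
qed (auto intro: typing.intros)

lemma fv_minst:
  "\<Theta> \<turnstile> M \<Ztypecolon> A \<Longrightarrow> length \<Theta> = k + length \<sigma> \<Longrightarrow> fv (minst k \<sigma> M) \<subseteq> fv M \<union> (\<Union>N \<in> set \<sigma>. fv N)"
proof (induction arbitrary: k rule: typing.induct)
  case (BVar i \<Theta>)
  then have "\<not> i < k \<Longrightarrow> \<sigma> ! (i - k) \<in> set \<sigma>" by simp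
  then show ?case by auto
next
  case (App \<Theta> M A B N)
  then show ?case by (simp, blast)
qed auto

text \<open>Terms without dangling indices are unchanged by lifting and by a later
  \<open>inst\<close>, so instantiating one index after the others agrees with doing all at
  once.\<close>

lemma inst_minst:
  "\<Theta> \<turnstile> M \<Ztypecolon> A \<Longrightarrow> length \<Theta> = Suc (k + length \<sigma>) \<Longrightarrow> \<forall>P \<in> set (N # \<sigma>). \<exists>B. [] \<turnstile> P \<Ztypecolon> B \<Longrightarrow>
     inst k N (minst (Suc k) \<sigma> M) = minst k (N # \<sigma>) M"
proof (induction arbitrary: k rule: typing.induct)
  case (BVar i \<Theta>)
  show ?case
  proof (cases "i \<le> k")
    case False
    then obtain j where j: "i = Suc (k + j)" by (metis less_iff_Suc_add not_le)
    then have "\<exists>B. [] \<turnstile> \<sigma> ! j \<Ztypecolon> B" using BVar by simp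
    then show ?thesis using j by (auto intro: typing_inst_id simp: Suc_diff_le)
  qed auto
next
  case (Abs A \<Theta> M B)
  then have "lift 0 N = N" by (auto intro: typing_lift_id)
  then show ?case using Abs by simp
qed auto

text \<open>The fundamental lemma of the logical predicate. Free variables are reflected, bound ones
  are covered by the assumption on \<open>\<sigma>\<close>, and an abstraction applied to a
  reducible argument is handled by beta-expansion.\<close>

lemma red_minst:
  "\<Theta> \<turnstile> M \<Ztypecolon> A \<Longrightarrow> list_all2 (\<lambda>N B. red B S N) \<sigma> \<Theta> \<Longrightarrow> fv M \<subseteq> S \<Longrightarrow> red A S (minst 0 \<sigma> M)"
proof (induction arbitrary: S \<sigma> rule: typing.induct)
  case (FVar \<Theta> x)
  then show ?case using apps_red[of x S "[]" "vty x" "[]"] by simp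
next
  case (BVar i \<Theta>)
  then show ?case by (simp add: list_all2_conv_all_nth)
next
  case (App \<Theta> M A B N)
  then show ?case by auto
next
  case (Abs A \<Theta> M B)
  have over: "list_all2 (\<lambda>N B. N \<in> terms_over S B) \<sigma> \<Theta>"
    using Abs.prems(1) by (auto elim: list_all2_mono intro: red_terms_over)
  then have ty: "list_all2 (\<lambda>N B. [] \<turnstile> N \<Ztypecolon> B) \<sigma> \<Theta>"
    by (auto simp: terms_over_def elim: list_all2_mono)
  have fvs: "\<forall>N \<in> set \<sigma>. fv N \<subseteq> S"
    using over by (fastforce simp: terms_over_def list_all2_conv_all_nth in_set_conv_nth)
  have len: "length \<sigma> = length \<Theta>" using Abs.prems(1) by (rule list_all2_lengthD)
  have tyM: "[A] \<turnstile> minst (Suc 0) \<sigma> M \<Ztypecolon> B"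
    using typing_minst[OF Abs.hyps, of "[A]"] ty by simp
  have fvM: "fv (minst (Suc 0) \<sigma> M) \<subseteq> S"
    using fv_minst[OF Abs.hyps, of "Suc 0" \<sigma>] fvs len Abs.prems(2) by auto
  have mem: "Abs A (minst (Suc 0) \<sigma> M) \<in> terms_over S (A \<rightarrow>\<^sub>t B)"
    using tyM fvM by (auto simp: terms_over_def intro: typing.Abs)
  have "red B S' (Abs A (minst (Suc 0) \<sigma> M) \<cdot> N)" if S': "S \<subseteq> S'" and N: "red A S' N" for S' N
  proof (rule red_conv)
    have "list_all2 (\<lambda>N B. red B S' N) \<sigma> \<Theta>"
      using Abs.prems(1) S' by (auto elim: list_all2_mono intro: red_mono)
    then show "red B S' (minst 0 (N # \<sigma>) M)"
      using N Abs.prems(2) S' by (intro Abs.IH) auto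
    have N': "N \<in> terms_over S' A" using N by (rule red_terms_over)
    then have "[] \<turnstile> N \<Ztypecolon> A" by (simp add: terms_over_def)
    moreover from this have "\<forall>P \<in> set (N # \<sigma>). \<exists>B. [] \<turnstile> P \<Ztypecolon> B"
      using ty by (fastforce simp: list_all2_conv_all_nth in_set_conv_nth)
    \<comment> \<open>Beta yields \<open>inst 0 N (minst (Suc 0) \<sigma> M)\<close>, which
      \<open>inst_minst\<close> merges into a single instantiation.\<close>
    ultimately show "[] \<turnstile> Abs A (minst (Suc 0) \<sigma> M) \<cdot> N \<approx> minst 0 (N # \<sigma>) M \<Ztypecolon> B"
      using conv.beta[OF tyM, of N] inst_minst[OF Abs.hyps, of 0 \<sigma> N] len by simp
    show "Abs A (minst (Suc 0) \<sigma> M) \<cdot> N \<in> terms_over S' B"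
      using mem N' S' by (blast intro: terms_over_App terms_over_mono)
  qed
  then show ?case using mem by simp
qed

text \<open>Instantiating with the empty list changes nothing, so the fundamental lemma makes
  \<open>M\<close> itself reducible, and reification applies.\<close>

lemma terms_over_norm: "M \<in> terms_over S A \<Longrightarrow> norm S M A"
  using red_minst[of "[]" M A S "[]"] minst_Nil[of "[]" M A] red_norm
  by (simp add: terms_over_def)

section \<open>Strong reductions\<close>

lemma exists_fresh_var: "finite V \<Longrightarrow> \<exists>x. x \<notin> V \<and> vty x = A"
proof -
  assume "finite V"
  then obtain n where "n \<notin> vname ` V" using ex_new_if_finite[OF infinite_UNIV_nat] by blast
  then show ?thesis by (intro exI[of _ "Var n A"]) force
qed

theorem theoremT:
  fixes \<Gamma> \<Delta> :: ctx and \<rho> :: "var \<Rightarrow> trm"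
  assumes "is_ctx \<Gamma>" and "is_ctx \<Delta>"
    and "substitution \<Gamma> \<Delta> \<rho>"
    and "\<And>\<Xi> a b As Bs Ms Ns.
      fresh_ctx \<Xi> \<Gamma> \<Delta> \<Longrightarrow>
      a \<in> set (\<Xi> @ \<Gamma>) \<Longrightarrow> b \<in> set (\<Xi> @ \<Gamma>) \<Longrightarrow>
      vty a = tys As \<Longrightarrow> vty b = tys Bs \<Longrightarrow>
      list_all2 (\<lambda>M A. M \<in> \<Lambda> (\<Xi> @ \<Delta>) A) Ms As \<Longrightarrow>
      list_all2 (\<lambda>N B. N \<in> \<Lambda> (\<Xi> @ \<Delta>) B) Ns Bs \<Longrightarrow>
      apps (subst_ext \<Xi> \<rho> a) Ms =\<^sub>\<beta>\<^sub>\<eta> apps (subst_ext \<Xi> \<rho> b) Ns \<Ztypecolon> Base \<Longrightarrow>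
      a = b \<and> (\<forall>i < length As. Ms ! i =\<^sub>\<beta>\<^sub>\<eta> Ns ! i \<Ztypecolon> As ! i)"
  shows "strong_reduction \<Gamma> \<Delta> \<rho>"
proof -
  note \<rho> = assms(3) and inj = assms(4)
  have main: "[] \<turnstile> M \<approx> N \<Ztypecolon> A"
    if "norm S M A" "S = set (\<Xi> @ \<Gamma>)" "fresh_ctx \<Xi> \<Gamma> \<Delta>" "N \<in> terms_over S A"
      "[] \<turnstile> subst \<Gamma> \<rho> M \<approx> subst \<Gamma> \<rho> N \<Ztypecolon> A" for S M N A \<Xi>
    using that
  proof (induction arbitrary: \<Xi> N rule: norm.induct)
    case (Base M S a As Ms)
    have "norm S N Base" using Base.prems by (intro terms_over_norm)
    then obtain b Bs Ns where N: "b \<in> S" "vty b = tys Bs" "list_all2 (norm S) Ns Bs"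
        "[] \<turnstile> N \<approx> apps (FVar b) Ns \<Ztypecolon> Base"
      by (cases rule: norm.cases) auto
    have Ms: "list_all2 (norm S) Ms As" using Base.IH by (auto elim: list_all2_mono)
    have image: "list_all2 (\<lambda>M A. M \<in> \<Lambda> (\<Xi> @ \<Delta>) A) (map (subst \<Gamma> \<rho>) Ps) Cs"
      if "list_all2 (norm S) Ps Cs" for Ps Cs
      using that Base.prems(1) subst_Terms[OF \<rho>, of _ \<Xi>] norm_terms_over
      by (auto simp: list_all2_conv_all_nth Terms_eq_terms_over)
    \<comment> \<open>\<open>\<Xi>\<close> is disjoint from \<open>\<Gamma>\<close>, so substituting
      on \<open>\<Gamma>\<close> alone acts on heads like the extension by the identity on
      \<open>\<Xi>\<close>.\<close>
    have head: "subst \<Gamma> \<rho> (FVar c) = subst_ext \<Xi> \<rho> c" if "c \<in> S" for c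
      using that Base.prems(1,2) by (auto simp: subst_ext_def fresh_ctx_def)
    have "[] \<turnstile> subst \<Gamma> \<rho> (apps (FVar a) Ms) \<approx> subst \<Gamma> \<rho> (apps (FVar b) Ns) \<Ztypecolon> Base"
      using subst_conv[OF \<rho> Base.hyps(4)] subst_conv[OF \<rho> N(4)] Base.prems(4)
      by (meson conv.sym conv.trans)
    then have "apps (subst_ext \<Xi> \<rho> a) (map (subst \<Gamma> \<rho>) Ms)
        =\<^sub>\<beta>\<^sub>\<eta> apps (subst_ext \<Xi> \<rho> b) (map (subst \<Gamma> \<rho>) Ns) \<Ztypecolon> Base"
      using head[OF Base.hyps(2)] head[OF N(1)] by (simp only: subst_apps)
    then have "a = b \<and> (\<forall>i < length As.
        map (subst \<Gamma> \<rho>) Ms ! i =\<^sub>\<beta>\<^sub>\<eta> map (subst \<Gamma> \<rho>) Ns ! i \<Ztypecolon> As ! i)"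
      using Base.hyps(2,3) N(1,2) Base.prems(1)
      by (intro inj[OF Base.prems(2) _ _ _ _ image[OF Ms] image[OF N(3)]]) auto
    then have ab: "a = b" and args: "\<And>i. i < length As \<Longrightarrow>
        map (subst \<Gamma> \<rho>) Ms ! i =\<^sub>\<beta>\<^sub>\<eta> map (subst \<Gamma> \<rho>) Ns ! i \<Ztypecolon> As ! i" by auto
    \<comment> \<open>The common head has only one type, so both argument lists have the same length
      and types.\<close>
    have AB: "As = Bs" using ab Base.hyps(3) N(2) by (simp add: tys_inject)
    have len: "length Ms = length As" "length Ns = length As"
      using Ms N(3) AB by (auto dest: list_all2_lengthD)
    have "\<forall>i < length As. [] \<turnstile> Ms ! i \<approx> Ns ! i \<Ztypecolon> As ! i"
    proof (intro allI impI)
      fix i assume i: "i < length As"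
      have "Ns ! i \<in> terms_over S (As ! i)"
        using N(3) AB i by (auto simp: list_all2_conv_all_nth intro: norm_terms_over)
      moreover have "[] \<turnstile> subst \<Gamma> \<rho> (Ms ! i) \<approx> subst \<Gamma> \<rho> (Ns ! i) \<Ztypecolon> As ! i"
        using args[OF i] i len by simp
      ultimately show "[] \<turnstile> Ms ! i \<approx> Ns ! i \<Ztypecolon> As ! i"
        using list_all2_nthD2[OF Base.IH i] Base.prems(1,2) by blast
    qed
    then have "[] \<turnstile> apps (FVar a) Ms \<approx> apps (FVar b) Ns \<Ztypecolon> Base"
      using ab len Base.hyps(3) typing.FVar[of "[]" a]
      by (intro conv_apps[of _ As]) (auto simp: tys_def intro: conv.refl)
    then show ?case using Base.hyps(4) N(4) by (meson conv.sym conv.trans)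
  next
    case (Fun M S A B)
    \<comment> \<open>Avoiding \<open>\<Delta>\<close> as well keeps \<open>x # \<Xi>\<close> a
      fresh context; avoiding \<open>\<Gamma>\<close> makes the substitution fix
      \<open>x\<close>.\<close>
    obtain x where x: "x \<notin> set (\<Xi> @ \<Gamma> @ \<Delta>)" "vty x = A"
      using exists_fresh_var[of "set (\<Xi> @ \<Gamma> @ \<Delta>)" A] by blast
    have xS: "x \<notin> S" using x Fun.prems(1) by auto
    have fvMN: "x \<notin> fv M" "x \<notin> fv N" and ty: "[] \<turnstile> M \<Ztypecolon> vty x \<rightarrow>\<^sub>t B" "[] \<turnstile> N \<Ztypecolon> vty x \<rightarrow>\<^sub>t B"
      using xS x(2) Fun.hyps(1) Fun.prems(3) by (auto simp: terms_over_def)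
    have "[] \<turnstile> M \<cdot> FVar x \<approx> N \<cdot> FVar x \<Ztypecolon> B"
    proof (rule Fun.IH[OF xS x(2), of "x # \<Xi>"])
      show "insert x S = set ((x # \<Xi>) @ \<Gamma>)" using Fun.prems(1) by simp
      show "fresh_ctx (x # \<Xi>) \<Gamma> \<Delta>"
        using Fun.prems(2) x(1) by (auto simp: fresh_ctx_def is_ctx_def)
      show "N \<cdot> FVar x \<in> terms_over (insert x S) B"
        using terms_over_mono[OF Fun.prems(3), of "insert x S"] terms_over_FVar[of x "insert x S"] x(2)
        by (intro terms_over_App[of N _ A]) auto
      show "[] \<turnstile> subst \<Gamma> \<rho> (M \<cdot> FVar x) \<approx> subst \<Gamma> \<rho> (N \<cdot> FVar x) \<Ztypecolon> B"
        using x Fun.prems(4) typing.FVar[of "[]" x] by (auto intro: conv.App conv.refl)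
    qed
    \<comment> \<open>Extensionality removes the auxiliary variable \<open>x\<close> again.\<close>
    then show ?case using conv_ext[OF _ fvMN ty] x(2) by simp
  qed
  show ?thesis
    unfolding strong_reduction_def
  proof (intro conjI allI impI ballI)
    fix \<Xi> M N
    assume "fresh_ctx \<Xi> \<Gamma> \<Delta>" "M \<in> \<Lambda> (\<Xi> @ \<Gamma>) Base" "N \<in> \<Lambda> (\<Xi> @ \<Gamma>) Base"
      "subst \<Gamma> \<rho> M =\<^sub>\<beta>\<^sub>\<eta> subst \<Gamma> \<rho> N \<Ztypecolon> Base"
    then show "M =\<^sub>\<beta>\<^sub>\<eta> N \<Ztypecolon> Base"
      using main[OF terms_over_norm] by (simp add: Terms_eq_terms_over)
  qed (rule \<rho>)
qed

end
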